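(* Let $d\ge4$, $c>0$ with $c^2\le1/5$, and $\delta\in(0,1)$. If the sample size satisfies $n\le\frac{1-2\delta}{8}\cdot\frac{\log d}{c^2}$, then for every estimator $\widehat T$ (a function of $n$ i.i.d. samples, taking values in partially directed graphs on $[d]$), $$\sup_{(T,P)}\Pr(\widehat T\neq\overline T)\ge\delta-\frac{\log2}{\log d},$$ where the supremum is over all polytrees $T$ on $[d]$ and all Gaussian distributions $P=\mathcal{N}(0,\Sigma)$ on $\mathbb{R}^d$ that are Markov to $T$ and $c$-strong tree-faithful to $T$, and the samples are drawn from $P$.
   Context: A polytree is a DAG whose underlying undirected graph is a tree. $P$ is Markov to a DAG $T$ if its density factorizes as $\prod_kP(x_k\mid x_{\mathrm{pa}_T(k)})$. A v-structure is a triple $j\to\ell\leftarrow k$ with $j,k$ nonadjacent. $\overline T$ is the CPDAG of $T$: the partially directed graph with the skeleton of $T$ whose directed edges are those oriented identically in every DAG Markov equivalent to $T$. For $\ell\in([d]\cup\{\emptyset\})\setminus\{j,k\}$, $\rho(X_j,X_k\mid X_\ell)$ is the partial correlation given $X_\ell$ (the ordinary correlation if $\ell=\emptyset$). $P$ is $c$-strong tree-faithful to $T$ if (1) for every edge $j-k$ of $T$ and every $\ell\in([d]\cup\{\emptyset\})\setminus\{j,k\}$, $|\rho(X_j,X_k\mid X_\ell)|\ge c$; and (2) for every v-structure $k\to\ell\leftarrow j$, $|\rho(X_k,X_j\mid X_\ell)|\ge c$. *)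

theory Defs
  imports "HOL-Probability.Probability"
begin

text \<open>Vertices [d] are the elements of a finite type 'd (d = CARD('d)).
  A directed graph on [d] is a relation E :: ('d \<times> 'd) set, (j,k) \<in> E meaning j \<rightarrow> k.
  A partially directed graph is encoded as a relation A: j \<rightarrow> k iff (j,k) \<in> A and (k,j) \<notin> A;
  j - k (undirected) iff both (j,k) \<in> A and (k,j) \<in> A.\<close>

definition is_dag :: "('d::finite \<times> 'd) set \<Rightarrow> bool" where
  "is_dag E \<longleftrightarrow> acyclic E"

definition skeleton :: "('d \<times> 'd) set \<Rightarrow> ('d \<times> 'd) set" where
  "skeleton E = E \<union> E\<inverse>"

definition adjacent :: "('d \<times> 'd) set \<Rightarrow> 'd \<Rightarrow> 'd \<Rightarrow> bool" where
  "adjacent E j k \<longleftrightarrow> (j, k) \<in> skeleton E"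

text \<open>Polytree: a DAG whose underlying undirected graph is a tree, i.e. connected
  with exactly d - 1 edges (E acyclic, so each skeleton edge is one element of E).\<close>
definition polytree :: "('d::finite \<times> 'd) set \<Rightarrow> bool" where
  "polytree E \<longleftrightarrow> is_dag E \<and> (\<forall>x y. (x, y) \<in> (skeleton E)\<^sup>*) \<and> card E = CARD('d) - 1"

definition vupd :: "real ^ 'd \<Rightarrow> 'd \<Rightarrow> real \<Rightarrow> real ^ 'd" where
  "vupd x k t = (\<chi> i. if i = k then t else x $ i)"

text \<open>A probability density f on R^d (w.r.t. Lebesgue measure) is Markov to the DAG E if it
  factorizes as a product over k of conditional densities of x_k given x_{pa(k)}
  (Lauritzen's recursive factorization: kernels g_k depending only on x_k, x_{pa(k)},
  nonnegative, integrating to 1 in x_k).\<close>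
definition markov_to :: "(real ^ 'd::finite \<Rightarrow> real) \<Rightarrow> ('d \<times> 'd) set \<Rightarrow> bool" where
  "markov_to f E \<longleftrightarrow>
     (\<exists>g :: 'd \<Rightarrow> real ^ 'd \<Rightarrow> real.
        (\<forall>k. g k \<in> borel_measurable borel) \<and>
        (\<forall>k x. g k x \<ge> 0) \<and>
        (\<forall>k x y. x $ k = y $ k \<and> (\<forall>j. (j, k) \<in> E \<longrightarrow> x $ j = y $ j) \<longrightarrow> g k x = g k y) \<and>
        (\<forall>k x. (\<integral>\<^sup>+ t. ennreal (g k (vupd x k t)) \<partial>lborel) = 1) \<and>
        (AE x in lborel. f x = (\<Prod>k\<in>UNIV. g k x)))"

definition prob_density :: "(real ^ 'd::finite \<Rightarrow> real) \<Rightarrow> bool" where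
  "prob_density f \<longleftrightarrow> f \<in> borel_measurable borel \<and> (\<forall>x. f x \<ge> 0) \<and>
     (\<integral>\<^sup>+ x. ennreal (f x) \<partial>lborel) = 1"

text \<open>Markov equivalence: the same distributions (with densities) are Markov to both DAGs.\<close>
definition markov_equiv :: "('d::finite \<times> 'd) set \<Rightarrow> ('d \<times> 'd) set \<Rightarrow> bool" where
  "markov_equiv G H \<longleftrightarrow> (\<forall>f. prob_density f \<longrightarrow> (markov_to f G \<longleftrightarrow> markov_to f H))"

text \<open>CPDAG: skeleton of T, j \<rightarrow> k kept directed iff it is oriented j \<rightarrow> k in every DAG
  Markov equivalent to T; otherwise undirected (both pairs present).\<close>
definition cpdag :: "('d::finite \<times> 'd) set \<Rightarrow> ('d \<times> 'd) set" where
  "cpdag T = {(j, k). (j, k) \<in> skeleton T \<and>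
                 \<not> (\<forall>G. is_dag G \<and> markov_equiv G T \<longrightarrow> (k, j) \<in> G)}"

definition v_structure :: "('d \<times> 'd) set \<Rightarrow> 'd \<Rightarrow> 'd \<Rightarrow> 'd \<Rightarrow> bool" where
  "v_structure E k l j \<longleftrightarrow> (k, l) \<in> E \<and> (j, l) \<in> E \<and> j \<noteq> k \<and> \<not> adjacent E j k"

text \<open>Gaussian N(0, \<Sigma>) with \<Sigma> symmetric positive definite.\<close>
definition cov_matrix :: "real ^ 'd ^ 'd \<Rightarrow> bool" where
  "cov_matrix S \<longleftrightarrow> transpose S = S \<and> (\<forall>x. x \<noteq> 0 \<longrightarrow> x \<bullet> (S *v x) > 0)"

definition gauss_density :: "real ^ 'd::finite ^ 'd \<Rightarrow> real ^ 'd \<Rightarrow> real" where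
  "gauss_density S x =
     exp (- (x \<bullet> (matrix_inv S *v x)) / 2) / sqrt ((2 * pi) ^ CARD('d) * det S)"

definition gaussian :: "real ^ 'd::finite ^ 'd \<Rightarrow> (real ^ 'd) measure" where
  "gaussian S = density lborel (\<lambda>x. ennreal (gauss_density S x))"

text \<open>(Partial) correlation computed from the covariance; None encodes the empty
  conditioning set.\<close>
definition pcorr :: "real ^ 'd ^ 'd \<Rightarrow> 'd \<Rightarrow> 'd \<Rightarrow> 'd option \<Rightarrow> real" where
  "pcorr S j k l = (case l of
      None \<Rightarrow> S $ j $ k / sqrt (S $ j $ j * S $ k $ k)
    | Some m \<Rightarrow>
        (S $ j $ k - S $ j $ m * S $ m $ k / S $ m $ m) /
        sqrt ((S $ j $ j - S $ j $ m * S $ m $ j / S $ m $ m) *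
              (S $ k $ k - S $ k $ m * S $ m $ k / S $ m $ m)))"

definition strong_tree_faithful :: "real \<Rightarrow> real ^ 'd ^ 'd \<Rightarrow> ('d \<times> 'd) set \<Rightarrow> bool" where
  "strong_tree_faithful c S T \<longleftrightarrow>
     (\<forall>j k l. adjacent T j k \<and> l \<noteq> Some j \<and> l \<noteq> Some k \<longrightarrow> \<bar>pcorr S j k l\<bar> \<ge> c) \<and>
     (\<forall>k l j. v_structure T k l j \<longrightarrow> \<bar>pcorr S k j (Some l)\<bar> \<ge> c)"

end

theory Submission
  imports Defs
begin

text \<open>
  Fix two vertices \<open>v\<close> and \<open>h\<close>. For each of the \<open>d - 2\<close> other vertices \<open>i\<close>, hang \<open>v\<close> on the leaf \<open>i\<close> of a
  star with hub \<open>h\<close>, orient the tree away from \<open>v\<close>, and let all variances be 1 and all edge correlations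
  be \<open>a\<close> with \<open>a\<^sup>2 = c\<^sup>2 / (1 - c\<^sup>2)\<close>. Conditioning an edge on a third vertex is worst when that
  vertex is adjacent to the edge, where the partial correlation is exactly
  \<open>a / sqrt (1 + a\<^sup>2) = c\<close>. The skeletons differ in the only neighbour of \<open>v\<close>, so the CPDAGs are distinct.

  The reference law keeps the star and makes \<open>v\<close> independent of it; it does not depend on \<open>i\<close>, and the second
  moment of the likelihood ratio is \<open>1 / (1 - a\<^sup>2) \<le> exp (5 c\<^sup>2 / 3)\<close>. Some decision region
  has reference mass at most \<open>1 / (d - 2) \<le> 1 / sqrt d\<close>, and by Cauchy-Schwarz the square of its probability under the
  corresponding tree is at most \<open>exp (5 n c\<^sup>2 / 3) / sqrt d\<close>. This \<open>\<chi>\<^sup>2\<close> bound replaces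
  Fano's inequality.
\<close>

section \<open>Densities on Euclidean space that factorize along a DAG\<close>

lemma borel_measurable_vec_lambda:
  fixes f :: "'a \<Rightarrow> 'd::finite \<Rightarrow> real"
  assumes "\<And>i. (\<lambda>x. f x i) \<in> borel_measurable M"
  shows "(\<lambda>x. \<chi> i. f x i) \<in> borel_measurable M"
  by (subst borel_measurable_euclidean_space) (auto simp: Basis_vec_def inner_axis assms)

lemma borel_measurable_vec_nth [measurable]:
  "(\<lambda>x :: real ^ 'd::finite. x $ i) \<in> borel_measurable borel"
  by (intro borel_measurable_continuous_onI continuous_intros)

lemma prod_Basis_vec:
  fixes x :: "real ^ 'd::finite"
  shows "(\<Prod>b\<in>Basis. x \<bullet> b) = (\<Prod>i\<in>UNIV. x $ i)"
proof -
  have B: "(Basis :: (real ^ 'd) set) = (\<lambda>i. axis i 1) ` UNIV"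
    by (auto simp: Basis_vec_def)
  show ?thesis
    unfolding B by (subst prod.reindex) (auto simp: inj_on_def axis_eq_axis inner_axis)
qed

text \<open>Boxes pull back to products of intervals and determine \<open>lborel\<close>. This moves
  integrals to a product measure, where coordinates can be integrated out one at a time.\<close>

lemma lborel_vec_eq_distr:
  "(lborel :: (real ^ 'd::finite) measure) = distr (Pi\<^sub>M UNIV (\<lambda>_. lborel)) borel (\<lambda>\<omega>. \<chi> i. \<omega> i)"
proof (rule lborel_eqI)
  interpret product_sigma_finite "\<lambda>_::'d. lborel :: real measure"
    by standard
  fix l u :: "real ^ 'd"
  assume "\<And>b. b \<in> Basis \<Longrightarrow> l \<bullet> b \<le> u \<bullet> b"
  then have le: "l $ i \<le> u $ i" for i
    by (metis axis_in_Basis_iff Basis_real_def inner_axis inner_real_def mult.right_neutral singletonI)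
  have meas: "(\<lambda>\<omega>. \<chi> i::'d. \<omega> i) \<in> borel_measurable (Pi\<^sub>M UNIV (\<lambda>_. lborel :: real measure))"
    by (rule borel_measurable_vec_lambda) measurable
  have "(\<lambda>\<omega>. \<chi> i. \<omega> i) -` box l u \<inter> space (Pi\<^sub>M UNIV (\<lambda>_. lborel :: real measure))
      = (\<Pi>\<^sub>E i\<in>UNIV. {l $ i <..< u $ i})"
    by (auto simp: space_PiM mem_box_cart PiE_def Pi_def extensional_def)
  then show "emeasure (distr (Pi\<^sub>M UNIV (\<lambda>_. lborel)) borel (\<lambda>\<omega>. \<chi> i. \<omega> i)) (box l u)
      = (\<Prod>b\<in>Basis. (u - l) \<bullet> b)"
    using le by (simp add: emeasure_distr meas emeasure_PiM prod_Basis_vec prod_ennreal)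
qed simp

lemma acyclic_imp_sink:
  fixes E :: "('d::finite \<times> 'd) set"
  assumes "acyclic E" "U \<noteq> {}"
  obtains k where "k \<in> U" "\<And>l. l \<in> U \<Longrightarrow> (k, l) \<notin> E"
proof -
  have "wf (E\<inverse>)"
    using assms(1) by (simp add: finite_acyclic_wf_converse)
  then show thesis
    using assms(2) that by (metis converse_iff ex_in_conv wfE_min)
qed

text \<open>Integrate out a sink first: no other kernel depends on its coordinate.\<close>
lemma nn_integral_markov_kernels:
  fixes g :: "'d::finite \<Rightarrow> real ^ 'd \<Rightarrow> real"
  assumes E: "acyclic E"
    and g [measurable]: "\<And>k. g k \<in> borel_measurable borel"
    and dep: "\<And>k x y. x $ k = y $ k \<Longrightarrow> (\<And>j. (j, k) \<in> E \<Longrightarrow> x $ j = y $ j) \<Longrightarrow> g k x = g k y"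
    and one: "\<And>k x. (\<integral>\<^sup>+ t. ennreal (g k (vupd x k t)) \<partial>lborel) = 1"
  shows "(\<integral>\<^sup>+ x. (\<Prod>k\<in>UNIV. ennreal (g k x)) \<partial>lborel) = 1"
proof -
  interpret product_sigma_finite "\<lambda>_::'d. lborel :: real measure"
    by standard
  have vec: "(\<lambda>\<omega>. \<chi> i::'d. \<omega> i) \<in> borel_measurable (Pi\<^sub>M U (\<lambda>_. lborel :: real measure))" for U
  proof (rule borel_measurable_vec_lambda)
    fix i
    show "(\<lambda>\<omega>. \<omega> i) \<in> borel_measurable (Pi\<^sub>M U (\<lambda>_. lborel :: real measure))"
    proof (cases "i \<in> U")
      \<comment> \<open>Elements of the product space are extensional, so a coordinate outside
        \<open>U\<close> is constantly \<open>undefined\<close>.\<close>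
      case False
      then have "(\<lambda>\<omega>. \<omega> i) \<in> borel_measurable (Pi\<^sub>M U (\<lambda>_. lborel :: real measure))
          \<longleftrightarrow> (\<lambda>\<omega>. undefined :: real) \<in> borel_measurable (Pi\<^sub>M U (\<lambda>_. lborel :: real measure))"
        by (intro measurable_cong) (auto simp: space_PiM PiE_def extensional_def)
      then show ?thesis
        by simp
    qed measurable
  qed
  have gvec: "(\<lambda>\<omega>. g k (\<chi> i. \<omega> i)) \<in> borel_measurable (Pi\<^sub>M U (\<lambda>_. lborel))" for k U
    by (rule measurable_compose[OF vec g])
  \<comment> \<open>The induction runs over subsets \<open>U\<close>, with the coordinates outside
    \<open>U\<close> frozen at \<open>undefined\<close>. This is harmless because \<open>dep\<close>
    and \<open>one\<close> hold at every point.\<close>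
  have "(\<integral>\<^sup>+ \<omega>. (\<Prod>k\<in>U. ennreal (g k (\<chi> i. \<omega> i))) \<partial>(Pi\<^sub>M U (\<lambda>_. lborel))) = 1" for U
  proof (induction "card U" arbitrary: U rule: less_induct)
    case (less U)
    show ?case
    proof (cases "U = {}")
      case False
      obtain k where k: "k \<in> U" and sink: "\<And>l. l \<in> U \<Longrightarrow> (k, l) \<notin> E"
        using acyclic_imp_sink[OF E False] by metis
      define V where "V = U - {k}"
      have U: "U = insert k V" and kV: "k \<notin> V"
        using k by (auto simp: V_def)
      have "g l (\<chi> i. fun_upd \<omega> k y i) = g l (\<chi> i. \<omega> i)" if "l \<in> V" for l \<omega> y
        using that sink[of l] kV U by (intro dep) auto
      moreover have "(\<chi> i. fun_upd \<omega> k y i) = vupd (\<chi> i. \<omega> i) k y" for \<omega> y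
        by (simp add: vupd_def vec_eq_iff)
      ultimately have split: "(\<Prod>l\<in>U. ennreal (g l (\<chi> i. fun_upd \<omega> k y i)))
          = (\<Prod>l\<in>V. ennreal (g l (\<chi> i. \<omega> i))) * ennreal (g k (vupd (\<chi> i. \<omega> i) k y))" for \<omega> y
        unfolding U using kV by (simp add: mult.commute)
      have [measurable]: "(\<lambda>t. g k (vupd x k t)) \<in> borel_measurable borel" for x
        unfolding vupd_def by (intro measurable_compose[OF _ g] borel_measurable_vec_lambda) measurable
      have "(\<integral>\<^sup>+ \<omega>. (\<Prod>l\<in>U. ennreal (g l (\<chi> i. \<omega> i))) \<partial>(Pi\<^sub>M U (\<lambda>_. lborel)))
          = (\<integral>\<^sup>+ \<omega>. (\<integral>\<^sup>+ y. (\<Prod>l\<in>U. ennreal (g l (\<chi> i. fun_upd \<omega> k y i))) \<partial>lborel)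
              \<partial>(Pi\<^sub>M V (\<lambda>_. lborel)))"
        using kV gvec unfolding U
        by (intro product_nn_integral_insert) auto
      also have "\<dots> = (\<integral>\<^sup>+ \<omega>. (\<Prod>l\<in>V. ennreal (g l (\<chi> i. \<omega> i))) \<partial>(Pi\<^sub>M V (\<lambda>_. lborel)))"
        unfolding split by (simp add: nn_integral_cmult one)
      also have "\<dots> = 1"
        using kV k by (intro less) (simp add: U)
      finally show ?thesis .
    qed (use emeasure_PiM[of "{}" "\<lambda>_. {}"] in \<open>simp add: space_PiM_empty PiE_empty_domain\<close>)
  qed
  from this[of UNIV] show ?thesis
    unfolding lborel_vec_eq_distr using vec
    by (subst nn_integral_distr) auto
qed

text \<open>The law of each broom, the reference law and the auxiliary density of the second-moment
  computation all get total mass 1 from here. Only one-dimensional normal integrals remain to be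
  evaluated.\<close>

lemma nn_integral_markov_to:
  assumes "is_dag E" "markov_to f E"
  shows "(\<integral>\<^sup>+ x. ennreal (f x) \<partial>lborel) = 1"
proof -
  obtain g where g: "\<forall>k. g k \<in> borel_measurable borel" "\<forall>k x. g k x \<ge> 0"
    "\<forall>k x y. x $ k = y $ k \<and> (\<forall>j. (j, k) \<in> E \<longrightarrow> x $ j = y $ j) \<longrightarrow> g k x = g k y"
    "\<forall>k x. (\<integral>\<^sup>+ t. ennreal (g k (vupd x k t)) \<partial>lborel) = 1"
    and f: "AE x in lborel. f x = (\<Prod>k\<in>UNIV. g k x)"
    using assms(2) unfolding markov_to_def by (elim exE conjE) (rule that)
  have "(\<integral>\<^sup>+ x. ennreal (f x) \<partial>lborel) = (\<integral>\<^sup>+ x. (\<Prod>k\<in>UNIV. ennreal (g k x)) \<partial>lborel)"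
    using f by (intro nn_integral_cong_AE) (auto simp: prod_ennreal g(2) elim!: eventually_mono)
  also have "\<dots> = 1"
    using assms(1) g by (intro nn_integral_markov_kernels[of E]) (auto simp: is_dag_def)
  finally show ?thesis .
qed

section \<open>Gaussian laws as probability measures\<close>

lemma borel_measurable_gauss_density [measurable]:
  fixes S :: "real ^ 'd::finite ^ 'd"
  shows "gauss_density S \<in> borel_measurable borel"
proof -
  have "continuous_on UNIV (\<lambda>x. x \<bullet> (matrix_inv S *v x))"
    by (intro continuous_intros matrix_vector_mult_linear_continuous_on)
  then have [measurable]: "(\<lambda>x. x \<bullet> (matrix_inv S *v x)) \<in> borel_measurable borel"
    by (rule borel_measurable_continuous_onI)
  show ?thesis
    unfolding gauss_density_def [abs_def] by measurable
qed

lemma space_gaussian [simp]: "space (gaussian S) = UNIV"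
  and sets_gaussian [simp, measurable_cong]: "sets (gaussian S) = sets borel"
  by (simp_all add: gaussian_def)

lemma prob_space_gaussian:
  assumes "is_dag E" "markov_to (gauss_density S) E"
  shows "prob_space (gaussian S)"
proof (rule prob_spaceI)
  have "emeasure (gaussian S) UNIV = (\<integral>\<^sup>+ x. ennreal (gauss_density S x) \<partial>lborel)"
    unfolding gaussian_def by (subst emeasure_density) auto
  then show "emeasure (gaussian S) (space (gaussian S)) = 1"
    using nn_integral_markov_to[OF assms] by simp
qed

section \<open>Gaussian linear structural equation models\<close>

text \<open>A permutation that never raises the rank preserves it everywhere, so only the identity
  contributes to the Leibniz sum; no order on the index type is needed.\<close>
lemma det_ranked:
  fixes A :: "'a::comm_ring_1 ^ 'd::finite ^ 'd" and r :: "'d \<Rightarrow> nat"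
  assumes "\<And>k j. k \<noteq> j \<Longrightarrow> A $ k $ j \<noteq> 0 \<Longrightarrow> r j < r k"
  shows "det A = (\<Prod>k\<in>UNIV. A $ k $ k)"
proof -
  let ?t = "\<lambda>p. of_int (sign p) * (\<Prod>k\<in>UNIV. A $ k $ p k)"
  have zero: "?t p = 0" if "p permutes UNIV" "p \<noteq> id" for p
  proof (rule ccontr)
    assume "?t p \<noteq> 0"
    then have nz: "A $ k $ p k \<noteq> 0" for k
      by (metis UNIV_I finite mult_zero_right prod_zero)
    have le: "r (p k) \<le> r k" for k
      using assms[of k "p k"] nz[of k] by (cases "p k = k") auto
    obtain k where "p k \<noteq> k"
      using \<open>p \<noteq> id\<close> by (auto simp: fun_eq_iff)
    then have "r (p k) < r k"
      using assms nz by metis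
    then have "(\<Sum>k\<in>UNIV. r (p k)) < (\<Sum>k\<in>UNIV. r k)"
      using le by (intro sum_strict_mono_ex1) auto
    moreover have "(\<Sum>k\<in>UNIV. r (p k)) = (\<Sum>k\<in>UNIV. r k)"
      using sum.permute[OF that(1), of r] by (simp add: o_def)
    ultimately show False
      by simp
  qed
  have "det A = (\<Sum>p\<in>{id}. ?t p)"
    unfolding det_def using zero
    by (intro sum.mono_neutral_right finite_permutations) (auto simp: permutes_id)
  then show ?thesis
    by (simp add: sign_id)
qed

lemma matrix_inv_eqI:
  fixes A B :: "real ^ 'd::finite ^ 'd"
  assumes "A ** B = mat 1"
  shows "matrix_inv A = B"
proof -
  have BA: "B ** A = mat 1"
    using assms by (simp add: matrix_left_right_inverse)
  then have "\<exists>C. A ** C = mat 1 \<and> C ** A = mat 1"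
    using assms by blast
  then have "A ** matrix_inv A = mat 1"
    unfolding matrix_inv_def by (rule someI2_ex) simp
  then have "B ** (A ** matrix_inv A) = B"
    by simp
  then show ?thesis
    by (simp add: matrix_mul_assoc BA)
qed

lemma inner_transpose_mult:
  fixes A :: "real ^ 'd::finite ^ 'd"
  shows "x \<bullet> (transpose A *v y) = (A *v x) \<bullet> y"
  by (metis dot_lmul_matrix vector_transpose_matrix)

definition diag :: "('d \<Rightarrow> real) \<Rightarrow> real ^ 'd ^ 'd" where
  "diag w = (\<chi> k l. if k = l then w k else 0)"

lemma diag_mult_vec: "(diag w *v x) $ k = w k * x $ k"
  by (simp add: diag_def matrix_vector_mult_def if_distrib[of "\<lambda>c. c * _"] cong: if_cong)

lemma det_diag: "det (diag w) = (\<Prod>k\<in>UNIV. w k)"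
  by (subst det_diagonal) (auto simp: diag_def)

lemma diag_mult_diag: "diag u ** diag w = diag (\<lambda>k. u k * w k)"
  by (simp add: vec_eq_iff diag_def matrix_matrix_mult_def if_distrib[of "\<lambda>c. c * _"] cong: if_cong)

lemma diag_one: "diag (\<lambda>_. 1) = mat 1"
  by (simp add: diag_def mat_def)

section \<open>Covariances diagonalized by a matrix of determinant one\<close>

context
  fixes A S :: "real ^ 'd::finite ^ 'd" and \<sigma> :: "'d \<Rightarrow> real"
  assumes det_A: "det A = 1"
    and \<sigma>: "\<And>k. \<sigma> k > 0"
    and ASA: "A ** S ** transpose A = diag (\<lambda>k. (\<sigma> k)\<^sup>2)"
begin

text \<open>Substituting \<open>x = transpose A *v y\<close> turns the quadratic form into a
  weighted sum of squares of \<open>y\<close>.\<close>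

lemma cov_matrix_of_diagonalized:
  assumes "transpose S = S"
  shows "cov_matrix S"
  unfolding cov_matrix_def
proof (intro conjI allI impI assms)
  fix x :: "real ^ 'd"
  assume "x \<noteq> 0"
  have "invertible (transpose A)"
    using det_A by (simp add: invertible_det_nz)
  then obtain C where "transpose A ** C = mat 1"
    by (auto simp: invertible_def)
  then have "transpose A *v (C *v x) = x"
    by (simp add: matrix_vector_mul_assoc)
  then obtain y where y: "x = transpose A *v y"
    by metis
  with \<open>x \<noteq> 0\<close> have "y \<noteq> 0"
    by auto
  then obtain k where k: "y $ k \<noteq> 0"
    by (auto simp: vec_eq_iff)
  have "x \<bullet> (S *v x) = y \<bullet> (A *v (S *v (transpose A *v y)))"
    unfolding y by (metis inner_transpose_mult transpose_transpose)
  also have "\<dots> = y \<bullet> (diag (\<lambda>k. (\<sigma> k)\<^sup>2) *v y)"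
    by (metis ASA matrix_vector_mul_assoc)
  also have "\<dots> = (\<Sum>k\<in>UNIV. (\<sigma> k * y $ k)\<^sup>2)"
    by (simp add: inner_vec_def diag_mult_vec power2_eq_square ac_simps)
  also have "\<dots> > 0"
    using k \<sigma>[of k] by (intro sum_pos2[of _ k]) auto
  finally show "x \<bullet> (S *v x) > 0" .
qed

lemma gauss_density_of_diagonalized:
  "gauss_density S x = (\<Prod>k\<in>UNIV. normal_density 0 (\<sigma> k) ((A *v x) $ k))"
proof -
  \<comment> \<open>The precision matrix, found by solving the hypothesis \<open>ASA\<close> for the
    inverse of \<open>S\<close>.\<close>
  let ?K = "transpose A ** diag (\<lambda>k. 1 / (\<sigma> k)\<^sup>2) ** A"
  have "invertible A"
    using det_A by (simp add: invertible_det_nz)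
  then obtain C where C: "C ** A = mat 1"
    by (auto simp: invertible_def)
  have "A ** (S ** ?K) = (A ** S ** transpose A) ** diag (\<lambda>k. 1 / (\<sigma> k)\<^sup>2) ** A"
    by (simp add: matrix_mul_assoc)
  also have "\<dots> = A"
    using \<sigma> by (simp add: ASA diag_mult_diag less_imp_neq[symmetric] diag_one)
  finally have "C ** (A ** (S ** ?K)) = C ** A"
    by simp
  then have "S ** ?K = mat 1"
    by (metis C matrix_mul_assoc matrix_mul_lid)
  then have inv: "matrix_inv S = ?K"
    by (rule matrix_inv_eqI)
  have "x \<bullet> (?K *v x) = (A *v x) \<bullet> (diag (\<lambda>k. 1 / (\<sigma> k)\<^sup>2) *v (A *v x))"
    by (metis inner_transpose_mult matrix_vector_mul_assoc)
  also have "\<dots> = (\<Sum>k\<in>UNIV. ((A *v x) $ k)\<^sup>2 / (\<sigma> k)\<^sup>2)"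
    by (simp add: inner_vec_def diag_mult_vec power2_eq_square)
  finally have quad: "x \<bullet> (matrix_inv S *v x) = (\<Sum>k\<in>UNIV. ((A *v x) $ k)\<^sup>2 / (\<sigma> k)\<^sup>2)"
    by (simp add: inv)
  have "det (A ** S ** transpose A) = (\<Prod>k\<in>UNIV. (\<sigma> k)\<^sup>2)"
    by (simp add: ASA det_diag)
  then have "det S = (\<Prod>k\<in>UNIV. (\<sigma> k)\<^sup>2)"
    by (simp add: det_mul det_A)
  then have "(2 * pi) ^ CARD('d) * det S = (\<Prod>k\<in>UNIV. sqrt (2 * pi * (\<sigma> k)\<^sup>2))\<^sup>2"
    by (simp add: prod_power_distrib prod.distrib del: real_sqrt_mult)
  then have sqrt: "sqrt ((2 * pi) ^ CARD('d) * det S) = (\<Prod>k\<in>UNIV. sqrt (2 * pi * (\<sigma> k)\<^sup>2))"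
    by (simp add: prod_nonneg)
  have "exp (- (x \<bullet> (matrix_inv S *v x)) / 2) = (\<Prod>k\<in>UNIV. exp (- ((A *v x) $ k)\<^sup>2 / (2 * (\<sigma> k)\<^sup>2)))"
    unfolding quad by (simp add: exp_sum[symmetric] sum_negf sum_divide_distrib ac_simps)
  then show ?thesis
    unfolding gauss_density_def sqrt normal_density_def by (simp add: prod_dividef prod.distrib)
qed

end

section \<open>Linear models with parent map \<open>p\<close>, coefficients \<open>b\<close> and
  noise scales \<open>\<sigma>\<close>\<close>

definition tree_density :: "('d \<Rightarrow> 'd) \<Rightarrow> ('d \<Rightarrow> real) \<Rightarrow> ('d \<Rightarrow> real) \<Rightarrow> real ^ 'd::finite \<Rightarrow> real" where
  "tree_density p b \<sigma> x = (\<Prod>k\<in>UNIV. normal_density (b k * x $ p k) (\<sigma> k) (x $ k))"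

lemma borel_measurable_normal_density_comp [measurable (raw)]:
  assumes [measurable]: "f \<in> borel_measurable M" "g \<in> borel_measurable M"
  shows "(\<lambda>x. normal_density (f x) \<sigma> (g x)) \<in> borel_measurable M"
  unfolding normal_density_def by measurable

lemma borel_measurable_tree_density [measurable]: "tree_density p b \<sigma> \<in> borel_measurable borel"
  unfolding tree_density_def [abs_def] by measurable

lemma tree_density_pos:
  assumes "\<And>k. \<sigma> k > 0"
  shows "tree_density p b \<sigma> x > 0"
  unfolding tree_density_def by (intro prod_pos) (simp add: normal_density_pos assms)

text \<open>The kernels are those of the equations
  \<open>X_k = b k * X_(p k) + \<sigma> k * noise\<close>. A root is encoded by coefficient 0;
  elsewhere \<open>p k \<noteq> k\<close> keeps the mean fixed while coordinate \<open>k\<close> is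
  integrated out.\<close>

lemma markov_to_tree_density:
  assumes "\<And>k. \<sigma> k > 0" and E: "\<And>k. b k \<noteq> 0 \<Longrightarrow> p k \<noteq> k \<and> (p k, k) \<in> E"
  shows "markov_to (tree_density p b \<sigma>) E"
  unfolding markov_to_def
proof (intro exI[of _ "\<lambda>k x. normal_density (b k * x $ p k) (\<sigma> k) (x $ k)"] conjI allI impI)
  show "(\<lambda>x :: real ^ 'a. normal_density (b k * x $ p k) (\<sigma> k) (x $ k)) \<in> borel_measurable borel" for k
    by measurable
  show "normal_density (b k * x $ p k) (\<sigma> k) (x $ k) = normal_density (b k * y $ p k) (\<sigma> k) (y $ k)"
    if "x $ k = y $ k \<and> (\<forall>j. (j, k) \<in> E \<longrightarrow> x $ j = y $ j)" for k and x y :: "real ^ 'a"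
    using that E[of k] by (cases "b k = 0") auto
  show "(\<integral>\<^sup>+ t. ennreal (normal_density (b k * vupd x k t $ p k) (\<sigma> k) (vupd x k t $ k)) \<partial>lborel) = 1"
    for k and x :: "real ^ 'a"
  proof -
    have "b k * vupd x k t $ p k = b k * x $ p k" for t
      using E[of k] by (cases "b k = 0") (auto simp: vupd_def)
    moreover have "vupd x k t $ k = t" for t
      by (simp add: vupd_def)
    ultimately show ?thesis
      using assms(1)[of k] by (simp only: nn_integral_eq_integral integrable_normal_density
          normal_density_nonneg AE_I2 integral_normal_density) simp
  qed
qed (auto simp: tree_density_def)

text \<open>The matrix \<open>I - B\<close> that sends \<open>x\<close> to its residuals. Written as
  a difference, it keeps diagonal entry 1 at a root with \<open>p k = k\<close> and
  \<open>b k = 0\<close>.\<close>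

definition sem_matrix :: "('d \<Rightarrow> 'd) \<Rightarrow> ('d \<Rightarrow> real) \<Rightarrow> real ^ 'd::finite ^ 'd" where
  "sem_matrix p b = (\<chi> k j. (if j = k then 1 else 0) - (if j = p k then b k else 0))"

lemma sum_sem_matrix:
  "(\<Sum>j\<in>UNIV. sem_matrix p b $ k $ j * f j) = f k - b k * f (p k)"
proof -
  have "sem_matrix p b $ k $ j * f j = (if j = k then f j else 0) - (if j = p k then b k * f j else 0)" for j
    by (simp add: sem_matrix_def algebra_simps)
  then show ?thesis
    by (simp add: sum_subtractf)
qed

lemma sem_matrix_mult_vec: "(sem_matrix p b *v x) $ k = x $ k - b k * x $ p k"
  by (simp add: matrix_vector_mult_def sum_sem_matrix)

text \<open>Entry \<open>(k, l)\<close> is the covariance of the residuals at \<open>k\<close> and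
  \<open>l\<close> when \<open>S\<close> is the covariance of the variables.\<close>

lemma sem_matrix_conj:
  "(sem_matrix p b ** S ** transpose (sem_matrix p b)) $ k $ l
    = (S $ k $ l - b k * S $ p k $ l) - b l * (S $ k $ p l - b k * S $ p k $ p l)"
proof -
  have "(sem_matrix p b ** S ** transpose (sem_matrix p b)) $ k $ l
      = (\<Sum>j\<in>UNIV. sem_matrix p b $ l $ j * (\<Sum>m\<in>UNIV. sem_matrix p b $ k $ m * S $ m $ j))"
    by (simp add: matrix_matrix_mult_def transpose_def mult.commute)
  then show ?thesis
    by (simp add: sum_sem_matrix)
qed

text \<open>The rank \<open>r\<close> places parents strictly earlier, so the matrix is
  unitriangular up to reordering.\<close>

lemma det_sem_matrix:
  fixes r :: "'d::finite \<Rightarrow> nat"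
  assumes "\<And>k. b k \<noteq> 0 \<Longrightarrow> r (p k) < r k"
  shows "det (sem_matrix p b) = 1"
proof -
  have "p k \<noteq> k \<or> b k = 0" for k
    using assms[of k] by (cases "b k = 0") auto
  then have "sem_matrix p b $ k $ k = 1" for k
    by (auto simp: sem_matrix_def)
  moreover have "det (sem_matrix p b) = (\<Prod>k\<in>UNIV. sem_matrix p b $ k $ k)"
    using assms by (intro det_ranked[of _ r]) (auto simp: sem_matrix_def split: if_splits)
  ultimately show ?thesis
    by simp
qed

lemma tree_density_eq_sem:
  "tree_density p b \<sigma> x = (\<Prod>k\<in>UNIV. normal_density 0 (\<sigma> k) ((sem_matrix p b *v x) $ k))"
  by (simp add: tree_density_def sem_matrix_mult_vec normal_density_def)

lemma acyclic_ranked: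
  fixes r :: "'d \<Rightarrow> nat"
  assumes "\<And>j k. (j, k) \<in> E \<Longrightarrow> r j < r k"
  shows "acyclic E"
  by (rule wf_acyclic, rule wf_subset[OF wf_measure[of r]]) (use assms in auto)

section \<open>The family of trees\<close>

text \<open>The tree \<open>v \<rightarrow> i \<rightarrow> h \<rightarrow> j\<close>, with \<open>j\<close> ranging over all remaining vertices:
  a star with hub \<open>h\<close> whose leaf \<open>i\<close> carries the extra vertex \<open>v\<close>.\<close>
definition broom_parent :: "'d \<Rightarrow> 'd \<Rightarrow> 'd \<Rightarrow> 'd \<Rightarrow> 'd" where
  "broom_parent v h i k = (if k = i then v else if k = h then i else h)"

text \<open>Indexing edges by their heads gives in-degree at most one and makes the edge count
  \<open>d - 1\<close> immediate. The root \<open>v\<close>, where \<open>broom_parent\<close> has a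
  junk value, is left out.\<close>

definition broom :: "'d \<Rightarrow> 'd \<Rightarrow> 'd \<Rightarrow> ('d \<times> 'd) set" where
  "broom v h i = (\<lambda>k. (broom_parent v h i k, k)) ` (- {v})"

definition depth :: "'d \<Rightarrow> 'd \<Rightarrow> 'd \<Rightarrow> 'd \<Rightarrow> nat" where
  "depth v h i k = (if k = v then 0 else if k = i then 1 else if k = h then 2 else 3)"

text \<open>\<open>a\<close> to the power of the tree distance; truncated subtraction in both directions
  gives the absolute difference of the depths.\<close>
definition broom_cov :: "real \<Rightarrow> 'd \<Rightarrow> 'd \<Rightarrow> 'd \<Rightarrow> real ^ 'd ^ 'd" where
  "broom_cov a v h i = (\<chi> k l. if k = l then 1
     else if depth v h i k = depth v h i l then a\<^sup>2
     else a ^ ((depth v h i k - depth v h i l) + (depth v h i l - depth v h i k)))"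

definition broom_coeff :: "real \<Rightarrow> 'd \<Rightarrow> 'd \<Rightarrow> real" where
  "broom_coeff a v k = (if k = v then 0 else a)"

text \<open>Noise variance \<open>1 - a\<^sup>2\<close> complements the variance
  \<open>a\<^sup>2\<close> inherited from the parent, so every vertex has variance 1.\<close>

definition broom_sd :: "real \<Rightarrow> 'd \<Rightarrow> 'd \<Rightarrow> real" where
  "broom_sd a v k = (if k = v then 1 else sqrt (1 - a\<^sup>2))"

text \<open>The joint density of two standard normals with correlation \<open>a\<close> is
  symmetric. This allows the edge between \<open>i\<close> and \<open>h\<close> to be
  reversed.\<close>

lemma normal_density_reversible:
  assumes "a\<^sup>2 < 1"
  shows "normal_density 0 1 x * normal_density (a * x) (sqrt (1 - a\<^sup>2)) y
    = normal_density 0 1 y * normal_density (a * y) (sqrt (1 - a\<^sup>2)) x"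
proof -
  have "- x\<^sup>2 / 2 - (y - a * x)\<^sup>2 / (2 * (1 - a\<^sup>2)) = - y\<^sup>2 / 2 - (x - a * y)\<^sup>2 / (2 * (1 - a\<^sup>2))"
    using assms by (simp add: divide_simps) (simp add: power2_eq_square algebra_simps)
  then have "exp (- x\<^sup>2 / 2) * exp (- (y - a * x)\<^sup>2 / (2 * (1 - a\<^sup>2)))
      = exp (- y\<^sup>2 / 2) * exp (- (x - a * y)\<^sup>2 / (2 * (1 - a\<^sup>2)))"
    by (simp add: mult_exp_exp)
  then show ?thesis
    using assms by (simp add: normal_density_def)
qed

text \<open>Completing the square; the constant \<open>1 / (1 - a\<^sup>2)\<close> is one plus the \<open>\<chi>\<^sup>2\<close>-divergence between
  a pair of standard normals with correlation \<open>a\<close> and an independent pair.\<close>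
lemma normal_density_square:
  assumes "a\<^sup>2 < 1"
  shows "normal_density 0 1 x * (normal_density (a * x) (sqrt (1 - a\<^sup>2)) y)\<^sup>2
    = 1 / (1 - a\<^sup>2) * (normal_density 0 (sqrt ((1 + a\<^sup>2) / (1 - a\<^sup>2))) x
        * normal_density (2 * a / (1 + a\<^sup>2) * x) (sqrt ((1 - a\<^sup>2) / (1 + a\<^sup>2))) y
        * normal_density 0 1 y)"
proof -
  define s where "s = 1 - a\<^sup>2"
  define t where "t = 1 + a\<^sup>2"
  have st: "s > 0" "t > 0"
    using assms by (simp_all add: s_def t_def add_pos_nonneg)
  have "- x\<^sup>2 / 2 - 2 * ((y - a * x)\<^sup>2 / (2 * s))
      = - x\<^sup>2 / (2 * (t / s)) - (y - 2 * a / t * x)\<^sup>2 / (2 * (s / t)) - y\<^sup>2 / 2"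
  proof -
    have *: "(y - 2 * a / t * x)\<^sup>2 = (t * y - 2 * a * x)\<^sup>2 / t\<^sup>2"
      using st by (simp add: power2_eq_square field_simps)
    \<comment> \<open>Over the common denominator \<open>2 * s * t\<close>, equality of the
      exponents becomes this polynomial identity.\<close>
    have "x\<^sup>2 * s * t + 2 * (y - a * x)\<^sup>2 * t = x\<^sup>2 * s\<^sup>2 + (t * y - 2 * a * x)\<^sup>2 + y\<^sup>2 * s * t"
      unfolding s_def t_def by (simp add: power2_eq_square algebra_simps)
    moreover have "- x\<^sup>2 / 2 - 2 * (u / (2 * s)) = - (x\<^sup>2 * s * t + 2 * u * t) / (2 * s * t)" for u
      using st by (simp add: field_simps)
    moreover have "- x\<^sup>2 / (2 * (t / s)) - (u / t\<^sup>2) / (2 * (s / t)) - y\<^sup>2 / 2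
        = - (x\<^sup>2 * s\<^sup>2 + u + y\<^sup>2 * s * t) / (2 * s * t)" for u
      using st by (simp add: divide_simps) (simp add: power2_eq_square algebra_simps)
    ultimately show ?thesis
      unfolding * by simp
  qed
  then have e: "exp (- x\<^sup>2 / 2) * (exp (- (y - a * x)\<^sup>2 / (2 * s)))\<^sup>2
      = exp (- x\<^sup>2 / (2 * (t / s))) * exp (- (y - 2 * a / t * x)\<^sup>2 / (2 * (s / t))) * exp (- y\<^sup>2 / 2)"
    by (simp add: mult_exp_exp exp_double[symmetric])
  have c: "(1 / sqrt (2 * pi * s))\<^sup>2 * s = 1 / sqrt (2 * pi * (t / s)) * (1 / sqrt (2 * pi * (s / t)))"
    using st by (simp add: power_divide real_sqrt_mult real_sqrt_divide field_simps)
  have "normal_density 0 1 x * (normal_density (a * x) (sqrt s) y)\<^sup>2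
      = 1 / sqrt (2 * pi) * (1 / sqrt (2 * pi * s))\<^sup>2
        * (exp (- x\<^sup>2 / 2) * (exp (- (y - a * x)\<^sup>2 / (2 * s)))\<^sup>2)"
    using st by (simp add: normal_density_def power_mult_distrib power_divide)
  also have "\<dots> = 1 / s * (1 / sqrt (2 * pi) * ((1 / sqrt (2 * pi * s))\<^sup>2 * s)
        * (exp (- x\<^sup>2 / 2) * (exp (- (y - a * x)\<^sup>2 / (2 * s)))\<^sup>2))"
    using st by simp
  also have "\<dots> = 1 / s * (normal_density 0 (sqrt (t / s)) x
        * normal_density (2 * a / t * x) (sqrt (s / t)) y * normal_density 0 1 y)"
    unfolding e c using st by (simp add: normal_density_def)
  finally show ?thesis
    unfolding s_def t_def .
qed

text \<open>Here \<open>l\<close> is reached from \<open>j\<close> through \<open>k\<close>. The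
  squared partial correlation is \<open>a\<^sup>2 * (1 - \<gamma>\<^sup>2) / (1 - a\<^sup>2 *
  \<gamma>\<^sup>2)\<close>, which decreases in \<open>\<gamma>\<close>; at the extreme
  \<open>\<gamma> = a\<close> it equals
  \<open>a\<^sup>2 / (1 + a\<^sup>2) = c\<^sup>2\<close>.\<close>

lemma pcorr_path:
  assumes one: "S $ j $ j = 1" "S $ k $ k = 1" "S $ l $ l = 1"
    and jk: "S $ j $ k = a" "S $ k $ j = a"
    and kl: "S $ k $ l = \<gamma>" "S $ l $ k = \<gamma>" and jl: "S $ j $ l = a * \<gamma>" "S $ l $ j = a * \<gamma>"
    and \<gamma>: "0 \<le> \<gamma>" "\<gamma> \<le> a" and a: "0 < a" "a < 1" and c: "c\<^sup>2 = a\<^sup>2 * (1 - c\<^sup>2)"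
  shows "c \<le> \<bar>pcorr S j k (Some l)\<bar>" "c \<le> \<bar>pcorr S k j (Some l)\<bar>"
proof -
  have g2: "\<gamma>\<^sup>2 \<le> a\<^sup>2" and a2: "a\<^sup>2 < 1"
    using \<gamma> a by (simp_all add: power_mono abs_square_less_1)
  have c1: "c\<^sup>2 \<le> 1"
  proof (rule ccontr)
    assume "\<not> c\<^sup>2 \<le> 1"
    then have "a\<^sup>2 * (1 - c\<^sup>2) < 0"
      using a by (intro mult_pos_neg) auto
    then show False
      using c by (smt (verit) zero_le_power2)
  qed
  have g: "\<gamma>\<^sup>2 < 1" and ag: "a\<^sup>2 * \<gamma>\<^sup>2 < 1"
    using g2 a2 mult_left_le[of "\<gamma>\<^sup>2" "a\<^sup>2"] by auto
  define D where "D = (1 - a\<^sup>2 * \<gamma>\<^sup>2) * (1 - \<gamma>\<^sup>2)"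
  have D: "D > 0"
    using g ag by (simp add: D_def)
  \<comment> \<open>After eliminating with \<open>c\<close>, the difference of the two sides
    factors; the second factor is nonnegative because
    \<open>\<gamma>\<^sup>2 \<le> a\<^sup>2\<close>.\<close>
  have "a\<^sup>2 * (1 - \<gamma>\<^sup>2) - c\<^sup>2 * (1 - a\<^sup>2 * \<gamma>\<^sup>2) = a\<^sup>2 * (c\<^sup>2 - \<gamma>\<^sup>2 * (1 - c\<^sup>2))"
    using c by (simp add: algebra_simps)
  moreover have "\<gamma>\<^sup>2 * (1 - c\<^sup>2) \<le> c\<^sup>2"
    using g2 c c1 by (metis diff_ge_0_iff_ge mult_right_mono)
  ultimately have le: "c\<^sup>2 * (1 - a\<^sup>2 * \<gamma>\<^sup>2) \<le> a\<^sup>2 * (1 - \<gamma>\<^sup>2)"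
    by (smt (verit) mult_nonneg_nonneg zero_le_power2)
  have "c * sqrt D \<le> a * (1 - \<gamma>\<^sup>2)"
  proof (rule power2_le_imp_le)
    have "(c * sqrt D)\<^sup>2 = c\<^sup>2 * (1 - a\<^sup>2 * \<gamma>\<^sup>2) * (1 - \<gamma>\<^sup>2)"
      using D by (simp add: power_mult_distrib D_def)
    also have "\<dots> \<le> a\<^sup>2 * (1 - \<gamma>\<^sup>2) * (1 - \<gamma>\<^sup>2)"
      using le g by (intro mult_right_mono) auto
    finally show "(c * sqrt D)\<^sup>2 \<le> (a * (1 - \<gamma>\<^sup>2))\<^sup>2"
      by (simp add: power2_eq_square ac_simps)
    show "0 \<le> a * (1 - \<gamma>\<^sup>2)"
      using a g by simp
  qed
  then have "c \<le> a * (1 - \<gamma>\<^sup>2) / sqrt D"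
    using D by (simp add: pos_le_divide_eq)
  moreover have "pcorr S j k (Some l) = a * (1 - \<gamma>\<^sup>2) / sqrt D"
      "pcorr S k j (Some l) = a * (1 - \<gamma>\<^sup>2) / sqrt D"
    by (simp_all add: pcorr_def one jk kl jl D_def power2_eq_square algebra_simps)
  ultimately show "c \<le> \<bar>pcorr S j k (Some l)\<bar>" "c \<le> \<bar>pcorr S k j (Some l)\<bar>"
    by (simp_all only: order_trans[OF _ abs_ge_self])
qed

section \<open>Graph and covariance of a single broom\<close>

context
  fixes v h i :: "'d::finite"
  assumes vh: "v \<noteq> h" and iv: "i \<noteq> v" and ih: "i \<noteq> h"
begin

lemma depth_broom_parent: "k \<noteq> v \<Longrightarrow> depth v h i (broom_parent v h i k) < depth v h i k"
  using vh iv ih by (auto simp: depth_def broom_parent_def)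

lemma acyclic_broom: "acyclic (broom v h i)"
  by (rule acyclic_ranked[of _ "depth v h i"]) (auto simp: broom_def intro: depth_broom_parent)

lemma polytree_broom: "polytree (broom v h i)"
proof -
  let ?R = "(skeleton (broom v h i))\<^sup>*"
  have par: "(broom_parent v h i k, k) \<in> ?R" "(k, broom_parent v h i k) \<in> ?R" if "k \<noteq> v" for k
    using that by (auto simp: skeleton_def broom_def intro!: r_into_rtrancl)
  have "(v, k) \<in> ?R \<and> (k, v) \<in> ?R" for k
  proof (induction "depth v h i k" arbitrary: k rule: less_induct)
    case less
    show ?case
    proof (cases "k = v")
      case False
      then show ?thesis
        using less[OF depth_broom_parent[OF False]] par[OF False] by (meson rtrancl_trans)
    qed auto
  qed
  then have "(x, y) \<in> ?R" for x y
    by (meson rtrancl_trans)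
  moreover have "card (broom v h i) = CARD('d) - 1"
    unfolding broom_def by (subst card_image) (auto simp: inj_on_def card_Diff_singleton Compl_eq_Diff_UNIV)
  ultimately show ?thesis
    using acyclic_broom by (simp add: polytree_def is_dag_def)
qed

text \<open>The skeleton alone thus determines \<open>i\<close>.\<close>

lemma broom_neighbour_v: "(v, k) \<in> skeleton (broom v h i) \<longleftrightarrow> k = i"
  using vh iv ih by (auto simp: skeleton_def broom_def broom_parent_def split: if_splits)

text \<open>Two parents of one vertex coincide, so clause (2) of faithfulness holds
  vacuously.\<close>

lemma no_v_structure_broom: "\<not> v_structure (broom v h i) k l j"
  by (auto simp: v_structure_def broom_def)

context
  fixes a :: real
  assumes a0: "0 < a" and a1: "a < 1"
begin

lemma a2: "a\<^sup>2 < 1"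
  using a0 a1 by (simp add: abs_square_less_1)

lemma broom_sd_pos: "broom_sd a v k > 0"
  using a2 by (simp add: broom_sd_def)

text \<open>This certifies \<open>broom_cov\<close> as the covariance of the linear model: the
  residuals are uncorrelated and have the prescribed variances. The cases are the positions
  \<open>v\<close>, \<open>i\<close>, \<open>h\<close> and other leaf for each index.\<close>

lemma broom_diagonalizes:
  "sem_matrix (broom_parent v h i) (broom_coeff a v) ** broom_cov a v h i
    ** transpose (sem_matrix (broom_parent v h i) (broom_coeff a v))
  = diag (\<lambda>k. (broom_sd a v k)\<^sup>2)"
  unfolding vec_eq_iff sem_matrix_conj
proof (intro allI)
  fix k l
  have s: "sqrt (1 - a\<^sup>2) ^ 2 = 1 - a\<^sup>2"
    using a2 by simp
  have k: "k = v \<or> k = i \<or> k = h \<or> (k \<noteq> v \<and> k \<noteq> i \<and> k \<noteq> h)"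
   and l: "l = v \<or> l = i \<or> l = h \<or> (l \<noteq> v \<and> l \<noteq> i \<and> l \<noteq> h)"
    by auto
  show "broom_cov a v h i $ k $ l - broom_coeff a v k * broom_cov a v h i $ broom_parent v h i k $ l
      - broom_coeff a v l * (broom_cov a v h i $ k $ broom_parent v h i l
        - broom_coeff a v k * broom_cov a v h i $ broom_parent v h i k $ broom_parent v h i l)
      = diag (\<lambda>k. (broom_sd a v k)\<^sup>2) $ k $ l"
    using k l vh iv ih s
    by (elim disjE conjE)
       (simp_all add: diag_def broom_sd_def broom_cov_def broom_coeff_def broom_parent_def depth_def
          eval_nat_numeral algebra_simps)
qed

lemma det_broom_sem: "det (sem_matrix (broom_parent v h i) (broom_coeff a v)) = 1"
  by (rule det_sem_matrix[of _ "depth v h i"]) (metis broom_coeff_def depth_broom_parent)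

lemma broom_cov_symmetric: "transpose (broom_cov a v h i) = broom_cov a v h i"
  by (simp add: vec_eq_iff transpose_def broom_cov_def add.commute)

lemma cov_matrix_broom: "cov_matrix (broom_cov a v h i)"
  by (rule cov_matrix_of_diagonalized[OF det_broom_sem broom_sd_pos broom_diagonalizes broom_cov_symmetric])

lemma gauss_density_broom:
  "gauss_density (broom_cov a v h i) = tree_density (broom_parent v h i) (broom_coeff a v) (broom_sd a v)"
  by (rule ext) (simp add: tree_density_eq_sem
      gauss_density_of_diagonalized[OF det_broom_sem broom_sd_pos broom_diagonalizes])

text \<open>Coefficients and scales are left general because the auxiliary density of the
  second-moment computation factorizes along the same tree with other values.\<close>

lemma markov_to_broom:
  assumes "\<And>k. \<sigma> k > 0" "b v = 0"
  shows "markov_to (tree_density (broom_parent v h i) b \<sigma>) (broom v h i)"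
proof (rule markov_to_tree_density)
  fix k assume "b k \<noteq> 0"
  then have "k \<noteq> v"
    using assms(2) by auto
  then show "broom_parent v h i k \<noteq> k \<and> (broom_parent v h i k, k) \<in> broom v h i"
    using depth_broom_parent[of k] by (auto simp: broom_def)
qed (rule assms)

text \<open>A vertex off an edge of a tree reaches the farther endpoint through the nearer one. Its
  correlation with the nearer endpoint is at most \<open>a\<close>, since their distance is at least
  1.\<close>

lemma broom_cov_branch:
  assumes k: "k \<noteq> v" and l: "l \<noteq> k" "l \<noteq> broom_parent v h i k"
  shows "broom_cov a v h i $ k $ l = a * broom_cov a v h i $ broom_parent v h i k $ l
       \<and> broom_cov a v h i $ broom_parent v h i k $ l \<le> a
    \<or> broom_cov a v h i $ broom_parent v h i k $ l = a * broom_cov a v h i $ k $ l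
       \<and> broom_cov a v h i $ k $ l \<le> a"
proof -
  have p: "a * a \<le> a" "a * (a * a) \<le> a"
    using a0 a1 by (auto simp: mult_left_le mult_le_one)
  have k': "k = i \<or> k = h \<or> (k \<noteq> v \<and> k \<noteq> i \<and> k \<noteq> h)"
   and l': "l = v \<or> l = i \<or> l = h \<or> (l \<noteq> v \<and> l \<noteq> i \<and> l \<noteq> h)"
    using k by auto
  show ?thesis
    using k' l' l vh iv ih p
    by (elim disjE conjE)
       (simp_all add: broom_cov_def broom_parent_def depth_def eval_nat_numeral)
qed

lemma strong_tree_faithful_broom:
  assumes c: "c\<^sup>2 = a\<^sup>2 * (1 - c\<^sup>2)"
  shows "strong_tree_faithful c (broom_cov a v h i) (broom v h i)"
proof -
  let ?S = "broom_cov a v h i"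
  have sym: "?S $ j $ k = ?S $ k $ j" for j k
    by (simp add: broom_cov_def add.commute)
  have diag: "?S $ k $ k = 1" for k
    by (simp add: broom_cov_def)
  have nonneg: "0 \<le> ?S $ j $ k" for j k
    using a0 by (simp add: broom_cov_def)
  \<comment> \<open>Both orders of the endpoints are covered because \<open>adjacent\<close> is
    symmetric. For a vertex \<open>m\<close>, \<open>pcorr_path\<close> is used with the endpoint
    nearer to \<open>m\<close> in the middle.\<close>
  have edge: "c \<le> \<bar>pcorr ?S (broom_parent v h i k) k l\<bar> \<and> c \<le> \<bar>pcorr ?S k (broom_parent v h i k) l\<bar>"
    if k: "k \<noteq> v" and l: "l \<noteq> Some k" "l \<noteq> Some (broom_parent v h i k)" for k l
  proof -
    let ?p = "broom_parent v h i k"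
    have pk: "?S $ ?p $ k = a"
      using k vh iv ih by (auto simp: broom_cov_def broom_parent_def depth_def)
    have kp: "?S $ k $ ?p = a"
      using pk sym by simp
    show ?thesis
    proof (cases l)
      case None
      have "c\<^sup>2 \<le> a\<^sup>2"
        using c zero_le_power2[of "a * c"] unfolding power_mult_distrib right_diff_distrib by linarith
      then have "c \<le> a"
        by (rule power2_le_imp_le) (use a0 in simp)
      then show ?thesis
        using a0 by (simp add: None pcorr_def diag pk kp)
    next
      case (Some m)
      then have m: "m \<noteq> k" "m \<noteq> ?p"
        using l by auto
      show ?thesis
        using broom_cov_branch[OF k m]
      proof (elim disjE conjE)
        assume "?S $ k $ m = a * ?S $ ?p $ m" "?S $ ?p $ m \<le> a"
        then show ?thesis
          unfolding Some
          by (intro conjI pcorr_path[where j = k and k = ?p and a = a and \<gamma> = "?S $ ?p $ m"]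
                a0 a1 c diag nonneg pk kp) (simp_all only: sym[of m])
      next
        assume "?S $ ?p $ m = a * ?S $ k $ m" "?S $ k $ m \<le> a"
        then show ?thesis
          unfolding Some
          by (intro conjI pcorr_path[where j = ?p and k = k and a = a and \<gamma> = "?S $ k $ m"]
                a0 a1 c diag nonneg pk kp) (simp_all only: sym[of m])
      qed
    qed
  qed
  then show ?thesis
    using no_v_structure_broom unfolding strong_tree_faithful_def
    by (auto simp: adjacent_def skeleton_def broom_def)
qed

end

end

section \<open>Recovering the tree from its CPDAG\<close>

lemma subset_cpdag: "is_dag T \<Longrightarrow> T \<subseteq> cpdag T"
  \<comment> \<open>\<open>T\<close> is Markov equivalent to itself and, being acyclic, contains no
    reversed copy of its own edges, so no edge of \<open>T\<close> is dropped.\<close>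
  unfolding cpdag_def skeleton_def is_dag_def markov_equiv_def
  by (auto simp: acyclic_def) (meson r_into_trancl trancl_trans)

lemma cpdag_subset_skeleton: "cpdag T \<subseteq> skeleton T"
  by (auto simp: cpdag_def)

text \<open>The edge from \<open>v\<close> to \<open>i\<close> lies in the first CPDAG, hence in the
  skeleton of the second broom, where \<open>j\<close> is the only neighbour of
  \<open>v\<close>.\<close>

lemma cpdag_broom_inject:
  assumes "v \<noteq> h" "i \<notin> {v, h}" "j \<notin> {v, h}" "cpdag (broom v h i) = cpdag (broom v h j)"
  shows "i = j"
proof -
  have "(v, i) \<in> broom v h i"
    using assms by (auto simp: broom_def broom_parent_def)
  then have "(v, i) \<in> cpdag (broom v h i)"
    using subset_cpdag acyclic_broom assms by (metis insertCI is_dag_def subsetD)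
  then have "(v, i) \<in> skeleton (broom v h j)"
    using assms(4) cpdag_subset_skeleton by blast
  then show ?thesis
    using broom_neighbour_v[of v h j] assms by auto
qed

section \<open>Change of measure for product measures\<close>

text \<open>A product measure is determined by its values on rectangles, and there the integral of
  the product density splits into factors.\<close>

lemma PiM_density:
  assumes "finite I" "prob_space Q" and r [measurable]: "r \<in> borel_measurable Q"
    and P: "prob_space (density Q r)"
  shows "Pi\<^sub>M I (\<lambda>_. density Q r) = density (Pi\<^sub>M I (\<lambda>_. Q)) (\<lambda>\<omega>. \<Prod>i\<in>I. r (\<omega> i))"
proof -
  interpret Q: prob_space Q by fact
  interpret P: prob_space "density Q r" by fact
  interpret PQ: product_sigma_finite "\<lambda>_. Q" by standard
  interpret PP: product_sigma_finite "\<lambda>_. density Q r" by standard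
  have [measurable]: "(\<lambda>\<omega>. \<Prod>i\<in>I. r (\<omega> i)) \<in> borel_measurable (Pi\<^sub>M I (\<lambda>_. Q))"
    by measurable
  have "density (Pi\<^sub>M I (\<lambda>_. Q)) (\<lambda>\<omega>. \<Prod>i\<in>I. r (\<omega> i)) = Pi\<^sub>M I (\<lambda>_. density Q r)"
  proof (rule PP.PiM_eqI)
    fix A assume A: "\<And>i. i \<in> I \<Longrightarrow> A i \<in> sets (density Q r)"
    then have AQ [measurable]: "\<And>i. i \<in> I \<Longrightarrow> A i \<in> sets Q"
      by simp
    have [measurable]: "Pi\<^sub>E I A \<in> sets (Pi\<^sub>M I (\<lambda>_. Q))"
      using AQ \<open>finite I\<close> by (intro sets_PiM_I_finite) auto
    have ind: "indicator (Pi\<^sub>E I A) \<omega> = (\<Prod>i\<in>I. indicator (A i) (\<omega> i) :: ennreal)"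
      if \<omega>: "\<omega> \<in> space (Pi\<^sub>M I (\<lambda>_. Q))" for \<omega>
    proof (cases "\<omega> \<in> Pi\<^sub>E I A")
      case True
      then show ?thesis
        by (auto simp: PiE_def Pi_def)
    next
      case False
      then obtain i where "i \<in> I" "\<omega> i \<notin> A i"
        using \<omega> by (auto simp: space_PiM PiE_def)
      then have "(\<Prod>i\<in>I. indicator (A i) (\<omega> i) :: ennreal) = 0"
        using \<open>finite I\<close> by (intro prod_zero bexI[of _ i]) auto
      then show ?thesis
        using False by simp
    qed
    have "emeasure (density (Pi\<^sub>M I (\<lambda>_. Q)) (\<lambda>\<omega>. \<Prod>i\<in>I. r (\<omega> i))) (Pi\<^sub>E I A)
        = (\<integral>\<^sup>+\<omega>. (\<Prod>i\<in>I. r (\<omega> i) * indicator (A i) (\<omega> i)) \<partial>Pi\<^sub>M I (\<lambda>_. Q))"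
      by (subst emeasure_density) (auto intro!: nn_integral_cong simp: prod.distrib ind)
    also have "\<dots> = (\<Prod>i\<in>I. \<integral>\<^sup>+x. r x * indicator (A i) x \<partial>Q)"
      using \<open>finite I\<close> AQ by (intro PQ.product_nn_integral_prod) auto
    also have "\<dots> = (\<Prod>i\<in>I. emeasure (density Q r) (A i))"
      using AQ by (intro prod.cong) (auto simp: emeasure_density)
    finally show "emeasure (density (Pi\<^sub>M I (\<lambda>_. Q)) (\<lambda>\<omega>. \<Prod>i\<in>I. r (\<omega> i))) (Pi\<^sub>E I A)
        = (\<Prod>i\<in>I. emeasure (density Q r) (A i))" .
  qed (use \<open>finite I\<close> in \<open>auto cong: sets_PiM_cong\<close>)
  then show ?thesis
    by simp
qed

text \<open>Cauchy-Schwarz for the likelihood ratio times the indicator of \<open>A\<close>; the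
  second moment of the product ratio is a power of the one-sample second moment.\<close>

lemma PiM_density_sq_le:
  assumes "finite I" "prob_space Q" and r [measurable]: "r \<in> borel_measurable Q"
    and "prob_space (density Q r)"
    and A [measurable]: "A \<in> sets (Pi\<^sub>M I (\<lambda>_. Q))"
  shows "(emeasure (Pi\<^sub>M I (\<lambda>_. density Q r)) A)\<^sup>2
    \<le> (\<integral>\<^sup>+x. (r x)\<^sup>2 \<partial>Q) ^ card I * emeasure (Pi\<^sub>M I (\<lambda>_. Q)) A"
proof -
  interpret Q: prob_space Q by fact
  interpret PQ: product_sigma_finite "\<lambda>_. Q" by standard
  have [measurable]: "(\<lambda>\<omega>. \<Prod>i\<in>I. r (\<omega> i)) \<in> borel_measurable (Pi\<^sub>M I (\<lambda>_. Q))"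
    by measurable
  have "(emeasure (Pi\<^sub>M I (\<lambda>_. density Q r)) A)\<^sup>2
      = (\<integral>\<^sup>+\<omega>. (\<Prod>i\<in>I. r (\<omega> i)) * indicator A \<omega> \<partial>Pi\<^sub>M I (\<lambda>_. Q))\<^sup>2"
    by (simp add: PiM_density assms(1,2,4) emeasure_density)
  also have "\<dots> \<le> (\<integral>\<^sup>+\<omega>. (\<Prod>i\<in>I. r (\<omega> i))\<^sup>2 \<partial>Pi\<^sub>M I (\<lambda>_. Q))
      * (\<integral>\<^sup>+\<omega>. (indicator A \<omega>)\<^sup>2 \<partial>Pi\<^sub>M I (\<lambda>_. Q))"
    by (rule Cauchy_Schwarz_nn_integral) measurable
  also have "(\<integral>\<^sup>+\<omega>. (\<Prod>i\<in>I. r (\<omega> i))\<^sup>2 \<partial>Pi\<^sub>M I (\<lambda>_. Q)) = (\<integral>\<^sup>+x. (r x)\<^sup>2 \<partial>Q) ^ card I"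
    using \<open>finite I\<close> PQ.product_nn_integral_prod[of I "\<lambda>_ x. (r x)\<^sup>2"]
    by (simp add: prod_power_distrib)
  also have "(\<integral>\<^sup>+\<omega>. (indicator A \<omega>)\<^sup>2 \<partial>Pi\<^sub>M I (\<lambda>_. Q)) = emeasure (Pi\<^sub>M I (\<lambda>_. Q)) A"
    by (simp add: power2_eq_square indicator_inter_arith[symmetric])
  finally show ?thesis .
qed

text \<open>Pigeonhole: disjoint regions have total mass at most 1.\<close>

lemma exists_small_decision_region:
  assumes "prob_space N" "finite J" "J \<noteq> {}" "\<And>i. i \<in> J \<Longrightarrow> A i \<in> sets N"
    and "disjoint_family_on A J"
  obtains i where "i \<in> J" "measure N (A i) \<le> 1 / card J"
proof -
  interpret prob_space N by fact
  have "(\<Sum>i\<in>J. measure N (A i)) = measure N (\<Union>i\<in>J. A i)"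
    using assms by (intro finite_measure_finite_Union[symmetric]) auto
  also have "\<dots> \<le> 1"
    by simp
  finally have "(\<Sum>i\<in>J. measure N (A i)) \<le> 1" .
  moreover have "1 < (\<Sum>i\<in>J. measure N (A i))" if "\<And>i. i \<in> J \<Longrightarrow> 1 / card J < measure N (A i)"
  proof -
    have "1 = (\<Sum>i\<in>J. 1 / real (card J))"
      using assms(2,3) by simp
    also have "\<dots> < (\<Sum>i\<in>J. measure N (A i))"
      using assms(2,3) that by (intro sum_strict_mono) auto
    finally show ?thesis .
  qed
  ultimately show thesis
    using that by (meson not_le)
qed

section \<open>The lower bound\<close>

text \<open>The reference law: \<open>v\<close> is independent of a star with hub \<open>h\<close> on the other vertices. Rooting the star
  at \<open>h\<close> makes it visible that \<open>i\<close> plays no role.\<close>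
definition star_density :: "real \<Rightarrow> 'd \<Rightarrow> 'd \<Rightarrow> real ^ 'd::finite \<Rightarrow> real" where
  "star_density a v h = tree_density (\<lambda>_. h)
     (\<lambda>k. if k = v \<or> k = h then 0 else a) (\<lambda>k. if k = v \<or> k = h then 1 else sqrt (1 - a\<^sup>2))"

lemma borel_measurable_star_density [measurable]: "star_density a v h \<in> borel_measurable borel"
  unfolding star_density_def by measurable

lemma nn_integral_star_density:
  assumes "a\<^sup>2 < 1" "v \<noteq> h"
  shows "(\<integral>\<^sup>+ x. ennreal (star_density a v h x) \<partial>lborel) = 1"
proof (rule nn_integral_markov_to)
  \<comment> \<open>The chosen graph includes an edge from \<open>h\<close> to \<open>v\<close>,
    which carries coefficient 0.\<close>
  show "is_dag ({h} \<times> (- {h}))"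
    unfolding is_dag_def by (rule acyclic_ranked[of _ "\<lambda>k. if k = h then 0 else 1"]) auto
  show "markov_to (star_density a v h) ({h} \<times> (- {h}))"
    unfolding star_density_def using assms by (intro markov_to_tree_density) (auto split: if_splits)
qed

section \<open>Second moment of the likelihood ratio\<close>

lemma prod_UNIV_3:
  fixes F :: "'d::finite \<Rightarrow> real"
  assumes "v \<noteq> h" "i \<noteq> v" "i \<noteq> h"
  shows "(\<Prod>k\<in>UNIV. F k) = F v * F i * F h * (\<Prod>k\<in>- {v, i, h}. F k)"
proof -
  have "UNIV = insert v (insert i (insert h (- {v, i, h})))"
    by auto
  then show ?thesis
    using assms by (metis (no_types, lifting) ComplD finite insertCI insertE mult.assoc prod.insert)
qed

text \<open>Reversing the edge between \<open>h\<close> and \<open>i\<close> in the star leaves a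
  difference from the broom only in the kernel at \<open>i\<close>. Completing the square in
  \<open>x $ v\<close> and \<open>x $ i\<close> then leaves a constant times another density along
  the broom, times the star density.\<close>

lemma broom_density_square:
  fixes v h i :: "'d::finite"
  assumes d: "v \<noteq> h" "i \<noteq> v" "i \<noteq> h" and a: "a\<^sup>2 < 1"
  shows "(tree_density (broom_parent v h i) (broom_coeff a v) (broom_sd a v) x)\<^sup>2
    = 1 / (1 - a\<^sup>2) * tree_density (broom_parent v h i)
          (\<lambda>k. if k = i then 2 * a / (1 + a\<^sup>2) else broom_coeff a v k)
          (\<lambda>k. if k = v then sqrt ((1 + a\<^sup>2) / (1 - a\<^sup>2))
               else if k = i then sqrt ((1 - a\<^sup>2) / (1 + a\<^sup>2)) else broom_sd a v k) x
        * star_density a v h x"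
proof -
  let ?s = "sqrt (1 - a\<^sup>2)"
  let ?N = normal_density
  define R where "R = (\<Prod>k\<in>- {v, i, h}. ?N (a * x $ h) ?s (x $ k))"
  have f: "tree_density (broom_parent v h i) (broom_coeff a v) (broom_sd a v) x
      = ?N 0 1 (x $ v) * ?N (a * x $ v) ?s (x $ i) * ?N (a * x $ i) ?s (x $ h) * R"
    unfolding tree_density_def prod_UNIV_3[OF d] R_def using d
    by (auto simp: broom_parent_def broom_coeff_def broom_sd_def intro!: prod.cong)
  have \<tau>: "tree_density (broom_parent v h i)
      (\<lambda>k. if k = i then 2 * a / (1 + a\<^sup>2) else broom_coeff a v k)
      (\<lambda>k. if k = v then sqrt ((1 + a\<^sup>2) / (1 - a\<^sup>2))
           else if k = i then sqrt ((1 - a\<^sup>2) / (1 + a\<^sup>2)) else broom_sd a v k) x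
      = ?N 0 (sqrt ((1 + a\<^sup>2) / (1 - a\<^sup>2))) (x $ v)
        * ?N (2 * a / (1 + a\<^sup>2) * x $ v) (sqrt ((1 - a\<^sup>2) / (1 + a\<^sup>2))) (x $ i)
        * ?N (a * x $ i) ?s (x $ h) * R"
    unfolding tree_density_def prod_UNIV_3[OF d] R_def using d
    by (auto simp: broom_parent_def broom_coeff_def broom_sd_def intro!: prod.cong)
  have g: "star_density a v h x = ?N 0 1 (x $ v) * (?N 0 1 (x $ i) * ?N (a * x $ i) ?s (x $ h)) * R"
    unfolding star_density_def tree_density_def prod_UNIV_3[OF d] R_def
      normal_density_reversible[OF a, of "x $ i" "x $ h"] using d
    by (auto intro!: prod.cong)
  show ?thesis
    unfolding f \<tau> g power_mult_distrib
    using normal_density_square[OF a, of "x $ v" "x $ i"]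
    by (simp only: power2_eq_square[of "?N 0 1 (x $ v)"] power2_eq_square[of R]
        power2_eq_square[of "?N (a * x $ i) ?s (x $ h)"] mult_ac)
qed

text \<open>This converts the exponential bound into the stated Fano form, with
  \<open>L = ln d\<close> and \<open>u = 1 - 2 * \<delta>\<close>. The exponent is
  \<open>- (y * w)\<close>, and \<open>exp z \<ge> 1 + z\<close> reduces the claim to a polynomial
  inequality.\<close>

lemma fano_exponent_bound:
  fixes L u :: real
  assumes "L > 0" "0 \<le> u" "u \<le> 1"
  shows "exp (5 / 48 * u * L - L / 4) \<le> (1 + u) / 2 + ln 2 / L"
proof -
  define y where "y = L / 4"
  have y: "y > 0" and L: "L = 4 * y"
    using assms by (simp_all add: y_def)
  define w where "w = 1 - 5 * u / 12"
  have w: "w > 0"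
    using assms by (simp add: w_def)
  have "(1 + u) * w \<ge> 1"
  proof -
    have "u * u \<le> u"
      using assms by (simp add: mult_left_le)
    then show ?thesis
      using assms by (simp add: w_def algebra_simps)
  qed
  then have "4 * y * y \<le> 4 * y * y * ((1 + u) * w)"
    using y by simp
  moreover have "0 \<le> (2 * y - 1)\<^sup>2" "0 \<le> y * u" "0 < y * w"
    using y w assms by simp_all
  \<comment> \<open>By \<open>(1 + u) * w \<ge> 1\<close>, right side minus left side is at least
    \<open>(2 * y - 1)\<^sup>2 + 4 * y * u + y * w\<close>.\<close>
  ultimately have "8 * y \<le> (4 * y * (1 + u) + 1) * (1 + y * w)"
    using y by (simp add: power2_eq_square algebra_simps w_def)
  then have "1 / (1 + y * w) \<le> (1 + u) / 2 + 1 / (8 * y)"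
    using y w by (simp add: field_simps add_pos_pos)
  also have "1 / (8 * y) \<le> ln 2 / L"
    using y ln2_ge_two_thirds by (simp add: L divide_simps)
  finally have "1 / (1 + y * w) \<le> (1 + u) / 2 + ln 2 / L"
    by simp
  moreover have "exp (5 / 48 * u * L - L / 4) = 1 / exp (y * w)"
    by (simp add: L w_def exp_minus[symmetric] inverse_eq_divide[symmetric] algebra_simps)
  moreover have "1 / exp (y * w) \<le> 1 / (1 + y * w)"
    using exp_ge_add_one_self[of "y * w"] y w by (intro divide_left_mono) (auto simp: add_pos_pos)
  ultimately show ?thesis
    by linarith
qed

text \<open>With \<open>f\<close> the broom density and \<open>g\<close> the reference density, the
  ratio \<open>r = f / g\<close> satisfies \<open>g * r\<^sup>2 = \<tau> / (1 - a\<^sup>2)\<close>.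
  Since \<open>\<tau>\<close> has mass 1, the second moment of \<open>r\<close> is
  \<open>1 / (1 - a\<^sup>2)\<close>.\<close>

lemma broom_test_bound:
  fixes v h i :: "'d::finite"
  assumes d: "v \<noteq> h" "i \<noteq> v" "i \<noteq> h" and a: "0 < a" "a < 1"
    and I: "finite I" and A: "A \<in> sets (Pi\<^sub>M I (\<lambda>_. borel))"
  shows "(measure (Pi\<^sub>M I (\<lambda>_. gaussian (broom_cov a v h i))) A)\<^sup>2
    \<le> (1 / (1 - a\<^sup>2)) ^ card I
        * measure (Pi\<^sub>M I (\<lambda>_. density lborel (\<lambda>x. ennreal (star_density a v h x)))) A"
proof -
  let ?S = "broom_cov a v h i"
  have a2: "a\<^sup>2 < 1"
    using a by (simp add: abs_square_less_1)
  define f where "f = gauss_density ?S"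
  define g where "g = star_density a v h"
  define \<tau> where "\<tau> = tree_density (broom_parent v h i)
      (\<lambda>k. if k = i then 2 * a / (1 + a\<^sup>2) else broom_coeff a v k)
      (\<lambda>k. if k = v then sqrt ((1 + a\<^sup>2) / (1 - a\<^sup>2))
           else if k = i then sqrt ((1 - a\<^sup>2) / (1 + a\<^sup>2)) else broom_sd a v k)"
  define Q where "Q = density lborel (\<lambda>x. ennreal (g x))"
  define r where "r x = ennreal (f x / g x)" for x
  have tree: "f = tree_density (broom_parent v h i) (broom_coeff a v) (broom_sd a v)"
    unfolding f_def by (rule gauss_density_broom[OF d a])
  have f_pos: "f x > 0" for x
    unfolding tree by (intro tree_density_pos broom_sd_pos[OF d a])
  have g_pos: "g x > 0" for x
    unfolding g_def star_density_def using a2 by (intro tree_density_pos) simp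
  have \<tau>_sd: "0 < (if k = v then sqrt ((1 + a\<^sup>2) / (1 - a\<^sup>2))
           else if k = i then sqrt ((1 - a\<^sup>2) / (1 + a\<^sup>2)) else broom_sd a v k)" for k
    using a2 broom_sd_pos[OF d a, of k] by (simp add: add_pos_nonneg)
  have \<tau>_pos: "\<tau> x > 0" for x
    unfolding \<tau>_def using \<tau>_sd by (rule tree_density_pos)
  have [measurable]: "f \<in> borel_measurable borel" "g \<in> borel_measurable borel" "\<tau> \<in> borel_measurable borel"
    unfolding f_def g_def \<tau>_def by measurable
  have r_meas: "r \<in> borel_measurable Q"
    unfolding r_def Q_def by measurable
  have "markov_to f (broom v h i)"
    unfolding tree
    by (rule markov_to_broom[OF d a]) (auto simp: broom_coeff_def broom_sd_pos[OF d a])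
  then have P: "prob_space (gaussian ?S)"
    unfolding f_def using acyclic_broom[OF d] by (intro prob_space_gaussian) (auto simp: is_dag_def)
  have "emeasure Q (space Q) = 1"
    using nn_integral_star_density[OF a2 d(1)] unfolding Q_def
    by (subst emeasure_density) (auto simp: g_def)
  then have Q: "prob_space Q"
    by (rule prob_spaceI)
  have dens: "gaussian ?S = density Q r"
  proof -
    have "ennreal (g x) * r x = ennreal (f x)" for x
      using f_pos[of x] g_pos[of x] by (simp add: r_def ennreal_mult[symmetric])
    then show ?thesis
      unfolding Q_def r_def gaussian_def f_def[symmetric] by (subst density_density_eq) auto
  qed
  have "(\<integral>\<^sup>+x. (r x)\<^sup>2 \<partial>Q) = (\<integral>\<^sup>+x. ennreal (1 / (1 - a\<^sup>2)) * ennreal (\<tau> x) \<partial>lborel)"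
  proof -
    have "ennreal (g x) * (r x)\<^sup>2 = ennreal (1 / (1 - a\<^sup>2)) * ennreal (\<tau> x)" for x
    proof -
      have "g x * (f x / g x)\<^sup>2 = 1 / (1 - a\<^sup>2) * \<tau> x"
        using broom_density_square[OF d a2, of x] g_pos[of x]
        unfolding tree[symmetric] \<tau>_def[symmetric] g_def[symmetric]
        by (simp add: power_divide power2_eq_square[of "g x"])
      moreover have "ennreal (g x) * (r x)\<^sup>2 = ennreal (g x * (f x / g x)\<^sup>2)"
        using f_pos[of x] g_pos[of x] by (simp add: r_def ennreal_power ennreal_mult)
      moreover have "ennreal (1 / (1 - a\<^sup>2) * \<tau> x) = ennreal (1 / (1 - a\<^sup>2)) * ennreal (\<tau> x)"
        using a2 \<tau>_pos[of x] by (intro ennreal_mult) auto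
      ultimately show ?thesis
        by simp
    qed
    moreover have "(\<integral>\<^sup>+x. (r x)\<^sup>2 \<partial>Q) = (\<integral>\<^sup>+x. ennreal (g x) * (r x)\<^sup>2 \<partial>lborel)"
      unfolding Q_def r_def by (subst nn_integral_density) auto
    ultimately show ?thesis
      by simp
  qed
  also have "\<dots> = ennreal (1 / (1 - a\<^sup>2)) * (\<integral>\<^sup>+x. ennreal (\<tau> x) \<partial>lborel)"
    by (rule nn_integral_cmult) measurable
  also have "(\<integral>\<^sup>+x. ennreal (\<tau> x) \<partial>lborel) = 1"
  proof (rule nn_integral_markov_to)
    show "is_dag (broom v h i)"
      using acyclic_broom[OF d] by (simp add: is_dag_def)
    show "markov_to \<tau> (broom v h i)"
      unfolding \<tau>_def using d
      by (intro markov_to_broom[OF d a] \<tau>_sd) (simp add: broom_coeff_def)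
  qed
  finally have r2: "(\<integral>\<^sup>+x. (r x)\<^sup>2 \<partial>Q) = ennreal (1 / (1 - a\<^sup>2))"
    by simp
  interpret PP: prob_space "Pi\<^sub>M I (\<lambda>_. gaussian ?S)"
    using P by (rule prob_space_PiM)
  interpret QQ: prob_space "Pi\<^sub>M I (\<lambda>_. Q)"
    using Q by (rule prob_space_PiM)
  have "sets (Pi\<^sub>M I (\<lambda>_. Q)) = sets (Pi\<^sub>M I (\<lambda>_. borel))"
    by (intro sets_PiM_cong) (auto simp: Q_def)
  then have AQ: "A \<in> sets (Pi\<^sub>M I (\<lambda>_. Q))"
    using A by simp
  have "(emeasure (Pi\<^sub>M I (\<lambda>_. gaussian ?S)) A)\<^sup>2
      \<le> ennreal (1 / (1 - a\<^sup>2)) ^ card I * emeasure (Pi\<^sub>M I (\<lambda>_. Q)) A"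
    using PiM_density_sq_le[OF I Q r_meas _ AQ] P unfolding dens r2 by simp
  then have "ennreal ((PP.prob A)\<^sup>2) \<le> ennreal ((1 / (1 - a\<^sup>2)) ^ card I * QQ.prob A)"
    using a2 by (simp add: PP.emeasure_eq_measure QQ.emeasure_eq_measure ennreal_power ennreal_mult)
  then show ?thesis
    using a2 unfolding Q_def g_def by (subst (asm) ennreal_le_iff) auto
qed

text \<open>With \<open>q = c\<^sup>2\<close> the left side is \<open>1 + q / (1 - 2 * q)\<close>,
  and \<open>q \<le> 1 / 5\<close> gives \<open>1 - 2 * q \<ge> 3 / 5\<close>, the source of the
  constant \<open>5 / 3\<close>.\<close>

lemma chi_square_factor_le:
  fixes c :: real
  assumes "c\<^sup>2 \<le> 1 / 5" "a\<^sup>2 = c\<^sup>2 / (1 - c\<^sup>2)"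
  shows "1 / (1 - a\<^sup>2) \<le> exp (5 / 3 * c\<^sup>2)"
proof -
  define q where "q = c\<^sup>2"
  have q: "0 \<le> q" "q \<le> 1 / 5"
    using assms by (simp_all add: q_def)
  have "1 / (1 - a\<^sup>2) = 1 + q / (1 - 2 * q)"
    using q unfolding assms(2) q_def[symmetric] by (simp add: field_simps)
  also have "q / (1 - 2 * q) \<le> 5 / 3 * q"
  proof -
    have "q * (q * 10) \<le> q * 2"
      using q by (intro mult_left_mono) auto
    then show ?thesis
      using q by (simp add: divide_simps algebra_simps)
  qed
  also have "1 + 5 / 3 * q \<le> exp (5 / 3 * q)"
    by (rule exp_ge_add_one_self)
  finally show ?thesis
    by (simp add: q_def)
qed

theorem theorem6:
  fixes c \<delta> :: real and n :: nat
    and That :: "(nat \<Rightarrow> real ^ 'd::finite) \<Rightarrow> ('d \<times> 'd) set"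
  assumes "CARD('d) \<ge> 4"
    and "c > 0" and "c\<^sup>2 \<le> 1 / 5"
    and "0 < \<delta>" and "\<delta> < 1"
    and "real n \<le> (1 - 2 * \<delta>) / 8 * (ln (real CARD('d)) / c\<^sup>2)"
    and "That \<in> measurable (PiM {..<n} (\<lambda>_. borel)) (count_space UNIV)"
  shows "(SUP TS \<in> {(T, S). polytree T \<and> cov_matrix S \<and> markov_to (gauss_density S) T
                           \<and> strong_tree_faithful c S T}.
            measure (PiM {..<n} (\<lambda>_. gaussian (snd TS)))
              {\<omega> \<in> space (PiM {..<n} (\<lambda>_. gaussian (snd TS))). That \<omega> \<noteq> cpdag (fst TS)})
         \<ge> \<delta> - ln 2 / ln (real CARD('d))"
proof -
  let ?D = "real CARD('d)"
  define L where "L = ln ?D"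
  define u where "u = 1 - 2 * \<delta>"
  have D: "?D \<ge> 4"
    using assms(1) by simp
  have L: "L > 0"
    using D by (simp add: L_def)
  \<comment> \<open>Since \<open>n\<close> is nonnegative, the sample-size hypothesis forces
    \<open>\<delta> \<le> 1 / 2\<close>.\<close>
  have "0 \<le> u / 8 * (L / c\<^sup>2)"
    using assms(6) unfolding u_def L_def by (rule order_trans[OF of_nat_0_le_iff])
  then have u: "0 \<le> u" "u \<le> 1"
    using L assms(2,4) by (auto simp: u_def zero_le_mult_iff zero_le_divide_iff)
  define a where "a = sqrt (c\<^sup>2 / (1 - c\<^sup>2))"
  have c2: "0 < c\<^sup>2" "c\<^sup>2 < 1"
    using assms(2,3) by auto
  have a_sq: "a\<^sup>2 = c\<^sup>2 / (1 - c\<^sup>2)"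
    using c2 by (simp add: a_def)
  have "c\<^sup>2 / (1 - c\<^sup>2) < 1"
    using c2 assms(3) by (simp add: divide_simps)
  then have a: "0 < a" "a < 1"
    using c2 by (simp_all add: a_def)
  have c_a: "c\<^sup>2 = a\<^sup>2 * (1 - c\<^sup>2)"
    using c2 by (simp add: a_sq)
  have "2 \<le> card (UNIV :: 'd set)"
    using assms(1) by simp
  then obtain V :: "'d set" where "card V = 2"
    by (rule obtain_subset_with_card_n)
  then obtain v h :: 'd where vh: "v \<noteq> h"
    by (auto simp: card_2_iff)
  have card_J: "real (card (- {v, h})) = ?D - 2"
    using vh assms(1) by (simp add: Compl_eq_Diff_UNIV card_Diff_subset of_nat_diff)
  define N where "N = Pi\<^sub>M {..<n} (\<lambda>_. density lborel (\<lambda>x. ennreal (star_density a v h x)))"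
  \<comment> \<open>The event that the estimator returns the CPDAG of broom \<open>i\<close>;
    distinct CPDAGs make these events disjoint.\<close>
  define A where "A i = {\<omega> \<in> space (Pi\<^sub>M {..<n} (\<lambda>_. borel)). That \<omega> = cpdag (broom v h i)}" for i
  have A_sets: "A i \<in> sets (Pi\<^sub>M {..<n} (\<lambda>_. borel))" for i
    using measurable_sets[OF assms(7), of "{cpdag (broom v h i)}"]
    by (simp add: A_def vimage_def Int_def conj_commute)
  have "emeasure (density lborel (\<lambda>x. ennreal (star_density a v h x))) UNIV = 1"
    using nn_integral_star_density[of a v h] a vh
    by (subst emeasure_density) (auto simp: abs_square_less_1)
  then have "prob_space N"
    unfolding N_def by (intro prob_space_PiM prob_spaceI) simp
  moreover have "sets N = sets (Pi\<^sub>M {..<n} (\<lambda>_. borel))"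
    unfolding N_def by (intro sets_PiM_cong) auto
  moreover have "A k \<inter> A l = {}" if "k \<in> - {v, h}" "l \<in> - {v, h}" "k \<noteq> l" for k l
    using cpdag_broom_inject[OF vh, of k l] that by (auto simp: A_def)
  then have "disjoint_family_on A (- {v, h})"
    unfolding disjoint_family_on_def by blast
  moreover have "- {v, h} \<noteq> {}"
  proof
    assume "- {v, h} = {}"
    then show False
      using card_J D by simp
  qed
  \<comment> \<open>The index is chosen under the reference law, which is common to all
    brooms.\<close>
  ultimately obtain i where i: "i \<in> - {v, h}" and small: "measure N (A i) \<le> 1 / card (- {v, h})"
    using exists_small_decision_region[of N "- {v, h}" A] A_sets by (metis finite)
  have d: "v \<noteq> h" "i \<noteq> v" "i \<noteq> h"
    using vh i by auto
  let ?T = "broom v h i" and ?S = "broom_cov a v h i"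
  have "markov_to (gauss_density ?S) ?T"
    unfolding gauss_density_broom[OF d a]
    by (rule markov_to_broom[OF d a]) (auto simp: broom_coeff_def broom_sd_pos[OF d a])
  then have mem: "(?T, ?S) \<in> {(T, S). polytree T \<and> cov_matrix S \<and> markov_to (gauss_density S) T
                           \<and> strong_tree_faithful c S T}"
    using polytree_broom[OF d] cov_matrix_broom[OF d a] strong_tree_faithful_broom[OF d a c_a] by simp
  let ?P = "Pi\<^sub>M {..<n} (\<lambda>_. gaussian ?S)"
  have prob: "prob_space (Pi\<^sub>M {..<n} (\<lambda>_. gaussian S))"
    if "polytree T" "markov_to (gauss_density S) T" for T and S :: "real ^ 'd ^ 'd"
    using that by (intro prob_space_PiM prob_space_gaussian) (auto simp: polytree_def)
  interpret P: prob_space ?P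
    using prob mem by blast
  have P_sets: "sets ?P = sets (Pi\<^sub>M {..<n} (\<lambda>_. borel))"
    by (intro sets_PiM_cong) auto
  have P_space: "space ?P = space (Pi\<^sub>M {..<n} (\<lambda>_. borel))"
    by (simp add: space_PiM)
  \<comment> \<open>With \<open>d = CARD('d)\<close>,
    \<open>(d - 2)\<^sup>2 - d = (d - 1) * (d - 4)\<close>, so \<open>d \<ge> 4\<close> yields
    \<open>d - 2 \<ge> sqrt d\<close>.\<close>
  have "?D - 2 \<ge> exp (L / 2)"
  proof (rule power2_le_imp_le)
    have "(exp (L / 2))\<^sup>2 = ?D"
      using D by (simp add: L_def exp_double[symmetric])
    moreover have "0 \<le> (?D - 1) * (?D - 4)"
      using D by (intro mult_nonneg_nonneg) auto
    ultimately show "(exp (L / 2))\<^sup>2 \<le> (?D - 2)\<^sup>2"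
      by (simp add: power2_eq_square algebra_simps)
  qed (use D in simp)
  then have "1 / (?D - 2) \<le> exp (- (L / 2))"
    using frac_le[of 1 1 "exp (L / 2)" "?D - 2"] by (simp add: exp_minus inverse_eq_divide)
  then have "measure N (A i) \<le> exp (- (L / 2))"
    using small unfolding card_J by linarith
  \<comment> \<open>The hypothesis bounds \<open>n * c\<^sup>2\<close> by \<open>u * L / 8\<close>,
    and \<open>5 / 3\<close> times \<open>1 / 8\<close> is \<open>5 / 24\<close>.\<close>
  moreover have "(1 / (1 - a\<^sup>2)) ^ n \<le> exp (5 / 24 * u * L)"
  proof -
    have "a\<^sup>2 < 1"
      using a by (simp add: abs_square_less_1)
    then have "(1 / (1 - a\<^sup>2)) ^ n \<le> exp (5 / 3 * c\<^sup>2) ^ n"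
      using chi_square_factor_le[OF assms(3) a_sq] by (intro power_mono) simp_all
    also have "\<dots> = exp (5 / 3 * c\<^sup>2 * n)"
      by (metis exp_of_nat2_mult)
    also have "5 / 3 * c\<^sup>2 * n \<le> 5 / 3 * c\<^sup>2 * (u / 8 * (L / c\<^sup>2))"
      using assms(6) unfolding u_def L_def by (intro mult_left_mono) auto
    also have "\<dots> = 5 / 24 * u * L"
      using c2 by simp
    finally show ?thesis
      by simp
  qed
  ultimately have "(1 / (1 - a\<^sup>2)) ^ n * measure N (A i) \<le> exp (5 / 24 * u * L) * exp (- (L / 2))"
    by (intro mult_mono) auto
  \<comment> \<open>The bound is on the squared probability, so taking roots halves both
    exponents.\<close>
  also have "\<dots> = (exp (5 / 48 * u * L - L / 4))\<^sup>2"
    by (simp add: exp_double[symmetric] mult_exp_exp)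
  finally have "(P.prob (A i))\<^sup>2 \<le> (exp (5 / 48 * u * L - L / 4))\<^sup>2"
    using broom_test_bound[OF d a finite_lessThan A_sets[of i]]
    unfolding N_def card_lessThan by linarith
  then have "P.prob (A i) \<le> exp (5 / 48 * u * L - L / 4)"
    by (rule power2_le_imp_le) simp
  also have "\<dots> \<le> (1 + u) / 2 + ln 2 / L"
    by (rule fano_exponent_bound[OF L u])
  also have "(1 + u) / 2 = 1 - \<delta>"
    by (simp add: u_def field_simps)
  finally have "\<delta> - ln 2 / L \<le> 1 - P.prob (A i)"
    by simp
  also have "\<dots> = P.prob (space ?P - A i)"
    by (rule P.prob_compl[symmetric]) (simp only: A_sets P_sets)
  also have "space ?P - A i = {\<omega> \<in> space ?P. That \<omega> \<noteq> cpdag ?T}"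
    unfolding A_def P_space by blast
  finally have err: "\<delta> - ln 2 / L \<le> P.prob {\<omega> \<in> space ?P. That \<omega> \<noteq> cpdag ?T}" .
  let ?err = "\<lambda>TS :: ('d \<times> 'd) set \<times> (real ^ 'd ^ 'd). measure (PiM {..<n} (\<lambda>_. gaussian (snd TS)))
      {\<omega> \<in> space (PiM {..<n} (\<lambda>_. gaussian (snd TS))). That \<omega> \<noteq> cpdag (fst TS)}"
  let ?M = "{(T :: ('d \<times> 'd) set, S). polytree T \<and> cov_matrix S \<and> markov_to (gauss_density S) T
      \<and> strong_tree_faithful c S T}"
  \<comment> \<open>A supremum of reals dominates its members only for a bounded family; here every
    value is a probability.\<close>
  have bdd: "bdd_above (?err ` ?M)"
  proof (rule bdd_aboveI2[of _ _ 1])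
    fix TS :: "('d \<times> 'd) set \<times> (real ^ 'd ^ 'd)"
    assume "TS \<in> ?M"
    then have "prob_space (PiM {..<n} (\<lambda>_. gaussian (snd TS)))"
      using prob[of "fst TS" "snd TS"] by (simp add: case_prod_beta)
    then show "?err TS \<le> 1"
      by (rule prob_space.prob_le_1)
  qed
  have "\<delta> - ln 2 / L \<le> ?err (?T, ?S)"
    using err by simp
  also have "\<dots> \<le> (SUP TS\<in>?M. ?err TS)"
    by (rule cSUP_upper[OF mem bdd])
  finally show ?thesis
    unfolding L_def .
qed

end
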